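(* Consider $\max_{S\subseteq V} f(S)$ subject to $|S|\le k$, for a monotone nondecreasing submodular $f$ with $f(\emptyset)=0$ and a positive integer $k$; let $\mathrm{OPT}$ be an optimal solution. Let $S_{\mathrm g}$ be the output of the greedy heuristic, and $S_0=\emptyset\subseteq S_1\subseteq\dots$ its successive sets. Let $\Lambda:=\min_i\{f(S_i)+\Delta(k\mid S_i)\}$, the minimum ranging over all these intermediate sets. Then $$f(\mathrm{OPT})\le\Lambda\le\frac{f(S_{\mathrm g})}{1-1/\mathrm e}\le\frac{f(\mathrm{OPT})}{1-1/\mathrm e}.$$
   Context: $f(v\mid S)=f(S\cup\{v\})-f(S)$. Greedy heuristic (with all costs equal to $1$ and budget $k$): starting from $S_{\mathrm g}=\emptyset$ and $V'=V$, repeatedly pick $u\in V'$ maximizing $f(u\mid S_{\mathrm g})$; add $u$ to $S_{\mathrm g}$ if $|S_{\mathrm g}|+1\le k$; remove $u$ from $V'$; stop when $V'=\emptyset$. $S_i$ denotes the set of the first $i$ elements added. For $S\subseteq V$, $\Delta(k\mid S)$ is the optimum of the LP $\max\sum_{v\in V\setminus S}f(v\mid S)x_v$ s.t. $\sum_v x_v\le k$, $0\le x_v\le 1$. Equivalently, it is the sum of the $k$ largest values $f(v\mid S)$, $v\in V\setminus S$, or of all of them if fewer than $k$ exist. *)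

theory Defs
  imports Complex_Main
begin

definition submodular_on :: "'a set \<Rightarrow> ('a set \<Rightarrow> real) \<Rightarrow> bool" where
  "submodular_on V f \<longleftrightarrow>
     (\<forall>A B. A \<subseteq> V \<longrightarrow> B \<subseteq> V \<longrightarrow> f (A \<union> B) + f (A \<inter> B) \<le> f A + f B)"

definition marginal :: "('a set \<Rightarrow> real) \<Rightarrow> 'a \<Rightarrow> 'a set \<Rightarrow> real" where
  "marginal f v S = f (S \<union> {v}) - f S"

definition optimal_solution :: "('a set \<Rightarrow> real) \<Rightarrow> 'a set \<Rightarrow> nat \<Rightarrow> 'a set \<Rightarrow> bool" where
  "optimal_solution f V k X \<longleftrightarrow>
     X \<subseteq> V \<and> card X \<le> k \<and> (\<forall>S. S \<subseteq> V \<longrightarrow> card S \<le> k \<longrightarrow> f S \<le> f X)"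

text \<open>The state of the greedy heuristic is a pair (\<open>us\<close>, \<open>R\<close>): \<open>us\<close> lists the elements
  added so far in the order of addition, so that the current solution is \<open>set us\<close>, and \<open>R\<close> is
  the set \<open>V'\<close> of elements not yet considered. Ties are broken arbitrarily, hence a relation:
  \<open>greedy_state f V k us R\<close> holds if some run reaches (\<open>us\<close>, \<open>R\<close>).\<close>

inductive greedy_state :: "('a set \<Rightarrow> real) \<Rightarrow> 'a set \<Rightarrow> nat \<Rightarrow> 'a list \<Rightarrow> 'a set \<Rightarrow> bool"
  for f :: "'a set \<Rightarrow> real" and V :: "'a set" and k :: nat where
  init: "greedy_state f V k [] V"
| add: "\<lbrakk>greedy_state f V k us R; u \<in> R;
         \<forall>w\<in>R. marginal f w (set us) \<le> marginal f u (set us);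
         card (set us) + 1 \<le> k\<rbrakk>
        \<Longrightarrow> greedy_state f V k (us @ [u]) (R - {u})"
| skip: "\<lbrakk>greedy_state f V k us R; u \<in> R;
          \<forall>w\<in>R. marginal f w (set us) \<le> marginal f u (set us);
          \<not> card (set us) + 1 \<le> k\<rbrakk>
         \<Longrightarrow> greedy_state f V k us (R - {u})"

definition greedy_run :: "('a set \<Rightarrow> real) \<Rightarrow> 'a set \<Rightarrow> nat \<Rightarrow> 'a list \<Rightarrow> bool" where
  "greedy_run f V k us \<longleftrightarrow> greedy_state f V k us {}"

definition greedy_prefix :: "'a list \<Rightarrow> nat \<Rightarrow> 'a set" where
  "greedy_prefix us i = set (take i us)"

definition lp_feasible :: "'a set \<Rightarrow> nat \<Rightarrow> 'a set \<Rightarrow> ('a \<Rightarrow> real) \<Rightarrow> bool" where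
  "lp_feasible V k S x \<longleftrightarrow>
     (\<Sum>v\<in>V - S. x v) \<le> real k \<and> (\<forall>v\<in>V - S. 0 \<le> x v \<and> x v \<le> 1)"

text \<open>The optimum of the linear program. For finite \<open>V\<close> the feasible region is nonempty (it
  contains 0) and, restricted to the coordinates in \<open>V - S\<close>, compact, so the supremum is an
  attained maximum.\<close>

definition lp_optimum :: "('a set \<Rightarrow> real) \<Rightarrow> 'a set \<Rightarrow> nat \<Rightarrow> 'a set \<Rightarrow> real" where
  "lp_optimum f V k S =
     (SUP x\<in>{x. lp_feasible V k S x}. \<Sum>v\<in>V - S. marginal f v S * x v)"

text \<open>The minimum is over all successive greedy sets, from the empty set up to and including
  the output.\<close>

definition greedy_bound :: "('a set \<Rightarrow> real) \<Rightarrow> 'a set \<Rightarrow> nat \<Rightarrow> 'a list \<Rightarrow> real" where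
  "greedy_bound f V k us =
     (MIN i\<in>{0..length us}. f (greedy_prefix us i) + lp_optimum f V k (greedy_prefix us i))"

end

theory Submission
  imports Defs
begin

text \<open>Submodularity bounds \<open>f OPT - f S\<close> by the sum of the marginals at \<open>S\<close> over \<open>OPT - S\<close>, and
  the indicator of \<open>OPT\<close> is feasible for the linear program. Conversely, the LP optimum at \<open>S\<^sub>i\<close> is
  at most \<open>k\<close> times the largest marginal, which is the gain of the next greedy step; so the gap
  \<open>\<Lambda> - f S\<^sub>i\<close> shrinks by a factor \<open>1 - 1/k\<close> in each of the \<open>k\<close> steps. If greedy stops earlier, then
  it has added all of \<open>V\<close>, where the LP optimum is \<open>0\<close>.\<close>

text \<open>The sets \<open>A \<union> B\<close> and \<open>A \<union> {v}\<close> meet exactly in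
  \<open>A\<close> when \<open>v\<close> is new, so submodularity says that \<open>v\<close> gains
  no more on top of \<open>A \<union> B\<close> than on top of \<open>A\<close>. Adding the elements
  of \<open>B\<close> one at a time sums these bounds.\<close>

lemma submodular_on_union_le_sum_marginal:
  assumes "submodular_on V f" "A \<subseteq> V" "finite B" "B \<subseteq> V - A"
  shows "f (A \<union> B) \<le> f A + (\<Sum>v\<in>B. marginal f v A)"
  using assms(3,4)
proof (induction B)
  case empty
  then show ?case by simp
next
  case (insert v B)
  have "f ((A \<union> B) \<union> (A \<union> {v})) + f ((A \<union> B) \<inter> (A \<union> {v})) \<le> f (A \<union> B) + f (A \<union> {v})"
    using assms(1,2) insert.prems unfolding submodular_on_def by (metis Diff_subset Un_least
        insert_subset subset_trans bot.extremum)
  moreover have "(A \<union> B) \<union> (A \<union> {v}) = A \<union> insert v B" "(A \<union> B) \<inter> (A \<union> {v}) = A"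
    using insert.hyps insert.prems by auto
  ultimately have "f (A \<union> insert v B) \<le> f (A \<union> B) + marginal f v A"
    by (simp add: marginal_def)
  then show ?case
    using insert.IH insert.prems insert.hyps by simp
qed

lemma lp_feasible_zero: "lp_feasible V k S (\<lambda>_. 0)"
  by (simp add: lp_feasible_def)

text \<open>A real supremum dominates its members only if the set is bounded above. Since
  \<open>0 \<le> x v \<le> 1\<close>, the sum of the absolute marginals is such a bound.\<close>

lemma lp_optimum_upper:
  assumes "lp_feasible V k S x"
  shows "(\<Sum>v\<in>V - S. marginal f v S * x v) \<le> lp_optimum f V k S"
  unfolding lp_optimum_def
proof (rule cSUP_upper)
  show "bdd_above ((\<lambda>x. \<Sum>v\<in>V - S. marginal f v S * x v) ` {x. lp_feasible V k S x})"
  proof (rule bdd_aboveI2)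
    fix y assume "y \<in> {x. lp_feasible V k S x}"
    then have y: "0 \<le> y v" "y v \<le> 1" if "v \<in> V - S" for v
      using that by (auto simp: lp_feasible_def)
    show "(\<Sum>v\<in>V - S. marginal f v S * y v) \<le> (\<Sum>v\<in>V - S. \<bar>marginal f v S\<bar>)"
    proof (rule sum_mono)
      fix v assume v: "v \<in> V - S"
      have "marginal f v S * y v \<le> \<bar>marginal f v S\<bar> * y v"
        using y(1)[OF v] by (intro mult_right_mono) auto
      also have "\<dots> \<le> \<bar>marginal f v S\<bar>"
        using y(2)[OF v] by (simp add: mult_left_le)
      finally show "marginal f v S * y v \<le> \<bar>marginal f v S\<bar>" .
    qed
  qed
qed (use assms in simp)

text \<open>Weak duality with \<open>c\<close> as the price of the budget constraint;
  \<open>0 \<le> c\<close> is what lets that inequality be multiplied by \<open>c\<close>.\<close>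

lemma lp_optimum_le:
  assumes "\<And>v. v \<in> V - S \<Longrightarrow> marginal f v S \<le> c" "0 \<le> c"
  shows "lp_optimum f V k S \<le> real k * c"
  unfolding lp_optimum_def
proof (rule cSUP_least)
  show "{x. lp_feasible V k S x} \<noteq> {}"
    using lp_feasible_zero by blast
  fix x assume "x \<in> {x. lp_feasible V k S x}"
  then have x: "(\<Sum>v\<in>V - S. x v) \<le> real k" "\<And>v. v \<in> V - S \<Longrightarrow> 0 \<le> x v"
    by (auto simp: lp_feasible_def)
  have "(\<Sum>v\<in>V - S. marginal f v S * x v) \<le> (\<Sum>v\<in>V - S. c * x v)"
    using assms x by (intro sum_mono mult_right_mono) auto
  also have "\<dots> = c * (\<Sum>v\<in>V - S. x v)"
    by (simp add: sum_distrib_left)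
  also have "\<dots> \<le> c * real k"
    using x(1) assms(2) by (rule mult_left_mono)
  finally show "(\<Sum>v\<in>V - S. marginal f v S * x v) \<le> real k * c"
    by (simp add: mult.commute)
qed

lemma submodular_on_le_lp_bound:
  assumes "finite V" "mono_on (Pow V) f" "submodular_on V f"
    and "S \<subseteq> V" "X \<subseteq> V" "card X \<le> k"
  shows "f X \<le> f S + lp_optimum f V k S"
proof -
  have fin: "finite X" and VX: "(V - S) \<inter> X = X - S"
    using assms finite_subset by auto
  have "card (X - S) \<le> k"
    using assms(6) fin by (meson Diff_subset card_mono order_trans)
  then have feas: "lp_feasible V k S (\<lambda>v. of_bool (v \<in> X))"
    using assms(1) VX by (simp add: lp_feasible_def)
  \<comment> \<open>\<open>X\<close> need not contain \<open>S\<close>; monotonicity pays for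
    enlarging it to \<open>S \<union> X\<close>.\<close>
  have "f X \<le> f (S \<union> (X - S))"
    using assms by (intro mono_onD[OF assms(2)]) auto
  also have "\<dots> \<le> f S + (\<Sum>v\<in>X - S. marginal f v S)"
    using assms fin by (intro submodular_on_union_le_sum_marginal[of V]) auto
  also have "(\<Sum>v\<in>X - S. marginal f v S) = (\<Sum>v\<in>V - S. marginal f v S * of_bool (v \<in> X))"
    using assms(1,5) by (intro sum.mono_neutral_cong_left) auto
  finally show ?thesis
    using lp_optimum_upper[OF feas, of f] by linarith
qed

text \<open>Elements are discarded only once \<open>k\<close> have been added. Before that
  \<open>R\<close> is all of \<open>V - set us\<close>, so each greedy choice is maximal over every
  element outside the current set, as the linear program requires. At \<open>R = {}\<close> the same
  clause shows that a run with fewer than \<open>k\<close> additions has taken all of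
  \<open>V\<close>.\<close>

lemma greedy_state_invariant:
  assumes "greedy_state f V k us R"
  shows "distinct us \<and> set us \<subseteq> V \<and> R \<subseteq> V - set us \<and> length us \<le> k
    \<and> (length us < k \<longrightarrow> R = V - set us)
    \<and> (\<forall>i<length us. \<forall>w\<in>V - greedy_prefix us i.
        marginal f w (greedy_prefix us i) \<le> f (greedy_prefix us (Suc i)) - f (greedy_prefix us i))"
  using assms
proof (induction rule: greedy_state.induct)
  case init
  then show ?case by simp
next
  case (add us R u)
  then have "card (set us) = length us"
    by (simp add: distinct_card)
  with add have len: "length us < k" and R: "R = V - set us"
    by auto
  have "marginal f w (greedy_prefix (us @ [u]) i)
      \<le> f (greedy_prefix (us @ [u]) (Suc i)) - f (greedy_prefix (us @ [u]) i)"
    if "i < Suc (length us)" "w \<in> V - greedy_prefix (us @ [u]) i" for i w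
  \<comment> \<open>Only the last prefix is new; appending \<open>u\<close> leaves the earlier ones
    unchanged.\<close>
  proof (cases "i = length us")
    case True
    with that add.hyps R show ?thesis
      by (simp add: greedy_prefix_def marginal_def)
  next
    case False
    with that have "i < length us" by simp
    with that add.IH show ?thesis
      by (simp add: greedy_prefix_def)
  qed
  with add len R show ?case by auto
next
  case (skip us R u)
  then show ?case by (auto simp: distinct_card)
qed

text \<open>Apply \<open>1 + x \<le> exp x\<close> at \<open>x = - 1 / k\<close> and raise to the
  power \<open>k\<close>; the base is nonnegative because \<open>k \<ge> 1\<close>.\<close>

lemma one_minus_inverse_power_le:
  assumes "k > 0"
  shows "(1 - 1 / real k) ^ k \<le> 1 / exp 1"
proof -
  have "(1 - 1 / real k) ^ k \<le> exp (- 1 / real k) ^ k"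
    using assms exp_ge_add_one_self[of "- 1 / real k"] by (intro power_mono) auto
  also have "\<dots> = exp (- 1)"
    using assms by (simp flip: exp_of_nat_mult)
  finally show ?thesis
    by (simp add: exp_minus field_simps)
qed

theorem theorem6p6:
  fixes V :: "'a set" and f :: "'a set \<Rightarrow> real" and k :: nat
    and OPT :: "'a set" and us :: "'a list"
  assumes "finite V"
    and "mono_on (Pow V) f"
    and "submodular_on V f"
    and "f {} = 0"
    and "k > 0"
    and "optimal_solution f V k OPT"
    and "greedy_run f V k us"
  shows "f OPT \<le> greedy_bound f V k us
    \<and> greedy_bound f V k us \<le> f (set us) / (1 - 1 / exp 1)
    \<and> f (set us) / (1 - 1 / exp 1) \<le> f OPT / (1 - 1 / exp 1)"
proof (intro conjI)
  let ?\<Lambda> = "greedy_bound f V k us" and ?S = "greedy_prefix us"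
  have inv: "distinct us" "set us \<subseteq> V" "length us \<le> k" "length us < k \<Longrightarrow> set us = V"
    and greedy: "\<And>i w. i < length us \<Longrightarrow> w \<in> V - ?S i \<Longrightarrow> marginal f w (?S i) \<le> f (?S (Suc i)) - f (?S i)"
    using greedy_state_invariant[OF assms(7)[unfolded greedy_run_def]] by auto
  have opt: "OPT \<subseteq> V" "card OPT \<le> k" "\<And>S. S \<subseteq> V \<Longrightarrow> card S \<le> k \<Longrightarrow> f S \<le> f OPT"
    using assms(6) by (auto simp: optimal_solution_def)
  have sub: "?S i \<subseteq> V" for i
    using inv(2) set_take_subset[of i us] by (auto simp: greedy_prefix_def)
  have all: "?S (length us) = set us"
    by (simp add: greedy_prefix_def)
  have mono: "f A \<le> f B" if "A \<subseteq> B" "B \<subseteq> V" for A B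
    using that by (intro mono_onD[OF assms(2)]) auto
  have e: "0 < 1 - 1 / exp (1::real)"
    by simp
  have nonneg: "0 \<le> f (set us)" "0 \<le> f OPT"
    using mono[of "{}"] inv(2) opt(1) assms(4) by auto
  have \<Lambda>_le: "?\<Lambda> \<le> f (?S i) + lp_optimum f V k (?S i)" if "i \<le> length us" for i
    using that unfolding greedy_bound_def by (intro Min_le) auto

  show "f OPT \<le> ?\<Lambda>"
    unfolding greedy_bound_def
    using submodular_on_le_lp_bound[OF assms(1-3) sub opt(1,2)] by (subst Min_ge_iff) auto
  \<comment> \<open>The sign is needed in both cases below, to scale inequalities between constants
    by \<open>?\<Lambda>\<close>.\<close>
  then have \<Lambda>: "0 \<le> ?\<Lambda>"
    using nonneg by linarith

  show "f (set us) / (1 - 1 / exp 1) \<le> f OPT / (1 - 1 / exp 1)"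
    using e inv by (intro divide_right_mono opt(3)) (auto simp: distinct_card)

  have "?\<Lambda> * (1 - 1 / exp 1) \<le> f (set us)"
  proof (cases "length us = k")
    case True
    have step: "?\<Lambda> - f (?S (Suc i)) \<le> (1 - 1 / real k) * (?\<Lambda> - f (?S i))" if "i < length us" for i
    proof -
      have "?S i \<subseteq> ?S (Suc i)"
        by (simp add: greedy_prefix_def set_take_subset_set_take)
      \<comment> \<open>The price \<open>c\<close> is the gain of the next greedy step, nonnegative
        by monotonicity.\<close>
      then have "lp_optimum f V k (?S i) \<le> real k * (f (?S (Suc i)) - f (?S i))"
        using greedy[OF that] mono[OF _ sub] by (intro lp_optimum_le) auto
      then have "?\<Lambda> - f (?S i) \<le> real k * (f (?S (Suc i)) - f (?S i))"
        using \<Lambda>_le[of i] that by linarith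
      then show ?thesis
        using assms(5) by (simp add: field_simps)
    qed
    have "?\<Lambda> - f (?S i) \<le> (1 - 1 / real k) ^ i * ?\<Lambda>" if "i \<le> length us" for i
      using that
    proof (induction i)
      case 0
      then show ?case by (simp add: greedy_prefix_def assms(4))
    next
      case (Suc i)
      have "?\<Lambda> - f (?S (Suc i)) \<le> (1 - 1 / real k) * (?\<Lambda> - f (?S i))"
        using Suc.prems by (intro step) simp
      also have "\<dots> \<le> (1 - 1 / real k) * ((1 - 1 / real k) ^ i * ?\<Lambda>)"
        using Suc assms(5) by (intro mult_left_mono) auto
      finally show ?case by (simp add: mult.assoc)
    qed
    from this[of k] have "?\<Lambda> - f (set us) \<le> (1 - 1 / real k) ^ k * ?\<Lambda>"
      using True all by simp
    also have "\<dots> \<le> 1 / exp 1 * ?\<Lambda>"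
      using one_minus_inverse_power_le[OF assms(5)] \<Lambda> by (rule mult_right_mono)
    finally show ?thesis by (simp add: algebra_simps)
  next
    case False
    with inv have "set us = V" by simp
    \<comment> \<open>No element lies outside \<open>set us\<close>, so the marginal bound holds
      vacuously with \<open>c = 0\<close>.\<close>
    then have "lp_optimum f V k (set us) \<le> real k * 0"
      by (intro lp_optimum_le) auto
    then have "?\<Lambda> \<le> f (set us)"
      using \<Lambda>_le[of "length us"] all by simp
    moreover have "?\<Lambda> * (1 - 1 / exp 1) \<le> ?\<Lambda>"
      using \<Lambda> by (intro mult_left_le) auto
    ultimately show ?thesis by linarith
  qed
  then show "?\<Lambda> \<le> f (set us) / (1 - 1 / exp 1)"
    using e by (simp only: pos_le_divide_eq)
qed

end
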